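(* Consider the Energy Sharing Game $(N,v_0)$ without admission fees, and let $\varepsilon_0^*$ be its least core value. (a) For any $\varepsilon\ge 0$ the following statements are equivalent: (i) $C_\varepsilon(N,v_0)\neq\emptyset$; (ii) $(\varepsilon,\dots,\varepsilon,v_0(N)-\varepsilon|U|)\in C_\varepsilon(N,v_0)$ (each user gets $\varepsilon$, the aggregator gets $v_0(N)-\varepsilon|U|$); (iii) $\displaystyle \varepsilon\le\min\Big\{\frac{v_0(N)-v_0(S)}{|N|-|S\cap U|}:\ S\in\mathcal{P}^a\Big\}$. (b) The exact value of $\varepsilon_0^*$ is $$\varepsilon_0^*=\min\Big\{\frac{v_0(N)-v_0(S)}{|N|-|S\cap U|}:\ S\in\mathcal{P}^a\Big\}.$$ (c) The following bounds hold: $$\varepsilon_0^*\ \ge\ \frac{v_0(N)-\max\{v_0(S):S\in\bar{\mathcal{P}}^a\}}{|N|},\qquad \varepsilon_0^*\ \le\ \min\Big\{\frac{v_0(N)}{|N|},\ \frac{v_0(N)-\max\{v_0(S):S\in\bar{\mathcal{P}}^a\}}{2}\Big\}.$$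
   Context: Energy Sharing Game without admission fees. The player set is $N=U\cup\{a\}$, where $U$ is a finite set of users with $|U|\ge 2$ and $a\notin U$ is the aggregator. Fix an integer $m\ge 1$. Each user $i\in U$ has: a compact set $D_i\subseteq\mathbb{R}^{n_i}\times\mathbb{R}^{2m}_+$, whose points are written $(z_i,y_i)$ with $y_i=[y_i^+,y_i^-]\in\mathbb{R}^m_+\times\mathbb{R}^m_+$, such that $D_i^z=\{z_i\in\mathbb{R}^{n_i}:(z_i,0)\in D_i\}$ is nonempty; and a continuous function $f_i:\mathbb{R}^{n_i+2m}\to\mathbb{R}$. There is also a continuous function $f_a:\mathbb{R}^m\to\mathbb{R}_+$ with $f_a(0)=0$. Put $b_i=\max\{f_i(z_i,0):z_i\in D_i^z\}$ and, for $S\subseteq N$ with $a\in S$ and $|S\cap U|\ge 2$, $$b_S=\max\Big\{\sum_{i\in S\cap U} f_i(z_i,y_i)+f_a\Big(\sum_{i\in S\cap U}y_i^+\Big):\ (z_i,y_i)\in D_i\ (i\in S\cap U),\ \sum_{i\in S\cap U}y_i^+=\sum_{i\in S\cap U}y_i^-\Big\}.$$ The characteristic function is $v_0(S)=b_S-\sum_{i\in S\cap U}b_i$ if $a\in S$ and $|S\cap U|\ge 2$, and $v_0(S)=0$ for every other $S\subseteq N$. Notation: $\mathcal{P}=\{S\subseteq N:S\ne\emptyset,S\ne N\}$, $\mathcal{P}^a=\{S\in\mathcal{P}:a\in S\}$, $\bar{\mathcal{P}}^a=\{S\in\mathcal{P}^a:|S|=|N|-1\}$. An allocation is a vector $x\in\mathbb{R}^{|N|}$,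 ordered with the aggregator's component last; $x(S)=\sum_{i\in S}x_i$. The strong $\varepsilon$-core is $C_\varepsilon(N,v)=\{x\in\mathbb{R}^{|N|}:x(N)=v(N),\ x(S)\ge v(S)+\varepsilon\ \forall S\in\mathcal{P}\}$. The least core value is the largest $\varepsilon\in\mathbb{R}$ with $C_\varepsilon(N,v)\ne\emptyset$. *)

theory Defs
  imports "HOL-Analysis.Analysis"
begin

text \<open>
  Decisions of a user are triples of a private part \<open>z\<close> and the two halves \<open>y\<^sup>+\<close> and \<open>y\<^sup>-\<close> of \<open>y\<close>.
  The dimension of \<open>z\<close> differs from user to user, so \<open>z\<close> lives in the library space
  \<^const>\<open>Euclidean_space\<close> (sequences vanishing from index \<open>n\<close> on); the dimension \<open>m\<close> of the two halves
  is common to all users and is the cardinality of the index type \<open>'m\<close>.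
\<close>

type_synonym 'm decision = "(nat \<Rightarrow> real) \<times> ((real, 'm) vec \<times> (real, 'm) vec)"

abbreviation y_plus :: "'m::finite decision \<Rightarrow> real^'m"
  where "y_plus w \<equiv> fst (snd w)"

abbreviation y_minus :: "'m::finite decision \<Rightarrow> real^'m"
  where "y_minus w \<equiv> snd (snd w)"

definition decision_space :: "nat \<Rightarrow> 'm::finite decision topology"
  where "decision_space n = prod_topology (Euclidean_space n) euclidean"

definition private_set :: "'m::finite decision set \<Rightarrow> (nat \<Rightarrow> real) set"
  where "private_set Di = {z. (z, 0) \<in> Di}"

text \<open>
  The maximum of a possibly infinite set of reals, as \<^const>\<open>Greatest\<close>: unlike a supremum,
  it has a determined value only when the set really has a greatest element.
\<close>

definition maximum :: "real set \<Rightarrow> real"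
  where "maximum A = (GREATEST r. r \<in> A)"

definition private_benefit ::
  "('p \<Rightarrow> 'm::finite decision set) \<Rightarrow> ('p \<Rightarrow> 'm decision \<Rightarrow> real) \<Rightarrow> 'p \<Rightarrow> real"
  where "private_benefit D f i = maximum {f i (z, 0) | z. z \<in> private_set (D i)}"

text \<open>Here \<open>T\<close> is the set of users of a coalition, i.e. \<open>S \<inter> U\<close>.\<close>

definition feasible_decisions ::
  "('p \<Rightarrow> 'm::finite decision set) \<Rightarrow> 'p set \<Rightarrow> ('p \<Rightarrow> 'm decision) set"
  where "feasible_decisions D T =
    {w. (\<forall>i\<in>T. w i \<in> D i) \<and> (\<Sum>i\<in>T. y_plus (w i)) = (\<Sum>i\<in>T. y_minus (w i))}"

definition coalition_benefit ::
  "('p \<Rightarrow> 'm::finite decision set) \<Rightarrow> ('p \<Rightarrow> 'm decision \<Rightarrow> real) \<Rightarrow> (real^'m \<Rightarrow> real) \<Rightarrow>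
    'p set \<Rightarrow> real"
  where "coalition_benefit D f fa T =
    maximum {(\<Sum>i\<in>T. f i (w i)) + fa (\<Sum>i\<in>T. y_plus (w i)) | w. w \<in> feasible_decisions D T}"

definition v0 ::
  "'p set \<Rightarrow> 'p \<Rightarrow> ('p \<Rightarrow> 'm::finite decision set) \<Rightarrow> ('p \<Rightarrow> 'm decision \<Rightarrow> real) \<Rightarrow>
    (real^'m \<Rightarrow> real) \<Rightarrow> 'p set \<Rightarrow> real"
  where "v0 U a D f fa S =
    (if a \<in> S \<and> card (S \<inter> U) \<ge> 2
     then coalition_benefit D f fa (S \<inter> U) - (\<Sum>i\<in>S \<inter> U. private_benefit D f i)
     else 0)"

text \<open>
  Standing assumptions of the game. Elements \<open>(z, y\<^sup>+, y\<^sup>-)\<close> of \<open>D i\<close> have nonnegative \<open>y\<^sup>+\<close>, \<open>y\<^sup>-\<close>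
  componentwise; \<^const>\<open>compactin\<close> includes that \<open>D i\<close> is a subset of the decision space.
\<close>

locale energy_sharing_game =
  fixes U :: "'p set"
    and a :: 'p
    and n :: "'p \<Rightarrow> nat"
    and D :: "'p \<Rightarrow> 'm::finite decision set"
    and f :: "'p \<Rightarrow> 'm decision \<Rightarrow> real"
    and fa :: "real^'m \<Rightarrow> real"
  assumes finite_users: "finite U"
    and two_users: "card U \<ge> 2"
    and aggregator: "a \<notin> U"
    and compact_D: "\<And>i. i \<in> U \<Longrightarrow> compactin (decision_space (n i)) (D i)"
    and nonneg_D: "\<And>i w k. i \<in> U \<Longrightarrow> w \<in> D i \<Longrightarrow> 0 \<le> y_plus w $ k \<and> 0 \<le> y_minus w $ k"
    and nonempty_D: "\<And>i. i \<in> U \<Longrightarrow> private_set (D i) \<noteq> {}"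
    and continuous_f: "\<And>i. i \<in> U \<Longrightarrow> continuous_map (decision_space (n i)) euclideanreal (f i)"
    and continuous_fa: "continuous_on UNIV fa"
    and nonneg_fa: "\<And>y. 0 \<le> fa y"
    and fa_0: "fa 0 = 0"

definition proper_coalitions :: "'p set \<Rightarrow> 'p set set"
  where "proper_coalitions N = {S. S \<subseteq> N \<and> S \<noteq> {} \<and> S \<noteq> N}"

definition proper_coalitions_with :: "'p set \<Rightarrow> 'p \<Rightarrow> 'p set set"
  where "proper_coalitions_with N a = {S \<in> proper_coalitions N. a \<in> S}"

definition maximal_coalitions_with :: "'p set \<Rightarrow> 'p \<Rightarrow> 'p set set"
  where "maximal_coalitions_with N a = {S \<in> proper_coalitions_with N a. card S = card N - 1}"

text \<open>Allocations are vectors indexed by the players themselves, as extensional functions on \<open>N\<close>.\<close>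

definition strong_core :: "'p set \<Rightarrow> ('p set \<Rightarrow> real) \<Rightarrow> real \<Rightarrow> ('p \<Rightarrow> real) set"
  where "strong_core N v \<epsilon> =
    {x \<in> N \<rightarrow>\<^sub>E UNIV. sum x N = v N \<and> (\<forall>S\<in>proper_coalitions N. sum x S \<ge> v S + \<epsilon>)}"

definition least_core_value :: "'p set \<Rightarrow> ('p set \<Rightarrow> real) \<Rightarrow> real"
  where "least_core_value N v = maximum {\<epsilon>. strong_core N v \<epsilon> \<noteq> {}}"

end

theory Submission
  imports Defs
begin

text \<open>
  Extending an optimal decision of a coalition by stand-alone optima (with \<open>y = 0\<close>) of further users
  keeps it feasible, so \<open>v0\<close> is monotone, nonnegative, and zero on coalitions without the aggregator.
  If \<open>x\<close> lies in the strong \<open>\<epsilon>\<close>-core and \<open>a \<in> S\<close>, adding the constraint of \<open>S\<close> to the singleton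
  constraints of the users outside \<open>S\<close> gives \<open>\<epsilon> (\<bar>N\<bar> - \<bar>S \<inter> U\<bar>) \<le> v N - v S\<close>; conversely, these
  inequalities are all that the allocation giving \<open>\<epsilon>\<close> to every user has to satisfy.
\<close>

section \<open>Maxima over compact sets of decisions\<close>

lemma maximum_eqI:
  assumes "m \<in> A" and "\<And>r. r \<in> A \<Longrightarrow> r \<le> m"
  shows "maximum A = m"
  unfolding maximum_def using assms by (rule Greatest_equality)

lemma maximum_attained:
  assumes "compact A" and "A \<noteq> {}"
  shows "maximum A \<in> A" and "\<And>r. r \<in> A \<Longrightarrow> r \<le> maximum A"
proof -
  obtain m where "m \<in> A" "\<And>r. r \<in> A \<Longrightarrow> r \<le> m"
    using compact_attains_sup[OF assms] by blast
  then have "maximum A = m" "m \<in> A" "\<And>r. r \<in> A \<Longrightarrow> r \<le> m"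
    by (auto intro: maximum_eqI)
  then show "maximum A \<in> A" and "\<And>r. r \<in> A \<Longrightarrow> r \<le> maximum A" by auto
qed

text \<open>Level sets of \<open>g\<close> are closed because points are closed in a T1 space. The
  topology \<open>X\<close> is explicit since the carrier of a decision space is not its whole type.
  The level set will be \<open>y = 0\<close> for a single user and the balance of the sums for a
  coalition.\<close>

lemma compact_image_on_level_set:
  fixes g :: "'b \<Rightarrow> 'c::t1_space" and h :: "'b \<Rightarrow> real"
  assumes "compactin X K" and "continuous_map X euclidean g" and "continuous_map X euclidean h"
  shows "compact (h ` {x \<in> K. g x = c})"
proof -
  have sub: "K \<subseteq> topspace X"
    using assms(1) by (rule compactin_subset_topspace)
  have "closedin X {x \<in> topspace X. g x \<in> {c}}"
    using assms(2) by (rule closedin_continuous_map_preimage) simp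
  with assms(1) have "compactin X (K \<inter> {x \<in> topspace X. g x \<in> {c}})"
    by (rule compact_Int_closedin)
  moreover have "K \<inter> {x \<in> topspace X. g x \<in> {c}} = {x \<in> K. g x = c}"
    using sub by auto
  ultimately have "compactin euclidean (h ` {x \<in> K. g x = c})"
    using assms(3) image_compactin by fastforce
  then show ?thesis by simp
qed

lemma continuous_map_y_plus:
    "continuous_map (decision_space n) euclidean (y_plus :: 'm::finite decision \<Rightarrow> real^'m)"
  and continuous_map_y_minus:
    "continuous_map (decision_space n) euclidean (y_minus :: 'm::finite decision \<Rightarrow> real^'m)"
proof -
  have snd: "continuous_map (decision_space n) euclidean snd"
    unfolding decision_space_def by (rule continuous_map_snd)
  have "continuous_map euclidean euclidean (fst :: (real^'m) \<times> (real^'m) \<Rightarrow> _)"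
    by (simp add: continuous_on_fst)
  from continuous_map_compose[OF snd this]
  show "continuous_map (decision_space n) euclidean (y_plus :: 'm decision \<Rightarrow> _)"
    by (simp add: o_def)
  have "continuous_map euclidean euclidean (snd :: (real^'m) \<times> (real^'m) \<Rightarrow> _)"
    by (simp add: continuous_on_snd)
  from continuous_map_compose[OF snd this]
  show "continuous_map (decision_space n) euclidean (y_minus :: 'm decision \<Rightarrow> _)"
    by (simp add: o_def)
qed

section \<open>The benefits are attained, and \<open>v0\<close> is monotone\<close>

context energy_sharing_game
begin

text \<open>The decisions with \<open>y = 0\<close> form a closed slice of the compact set
  \<open>D i\<close>.\<close>

lemma private_benefit_attained:
  assumes "i \<in> U"
  obtains z where "(z, 0) \<in> D i" and "f i (z, 0) = private_benefit D f i"
proof -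
  let ?V = "{f i (z, 0) | z. z \<in> private_set (D i)}"
  have V: "?V = f i ` {w \<in> D i. snd w = 0}"
    by (force simp: private_set_def)
  have "continuous_map (decision_space (n i)) euclidean (snd :: 'm decision \<Rightarrow> _)"
    unfolding decision_space_def by (rule continuous_map_snd)
  then have "compact ?V"
    unfolding V using compact_D[OF assms] continuous_f[OF assms]
    by (intro compact_image_on_level_set)
  moreover have "?V \<noteq> {}"
    using nonempty_D[OF assms] by auto
  ultimately have "private_benefit D f i \<in> ?V"
    unfolding private_benefit_def by (rule maximum_attained(1))
  then show thesis
    using that by (auto simp: private_set_def)
qed

text \<open>A user with \<open>y = 0\<close> adds nothing to either side of the balance. With
  \<open>A = {}\<close> this shows that feasible decisions exist; with general \<open>A\<close> it
  yields monotonicity.\<close>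

lemma feasible_decisions_extend:
  assumes "w \<in> feasible_decisions D A" and "A \<subseteq> B" and "B \<subseteq> U"
    and "\<And>i. i \<in> B - A \<Longrightarrow> (z i, 0) \<in> D i"
  defines "w' \<equiv> \<lambda>i. if i \<in> A then w i else (z i, 0)"
  shows "w' \<in> feasible_decisions D B"
    and "(\<Sum>i\<in>B. y_plus (w' i)) = (\<Sum>i\<in>A. y_plus (w i))"
    and "(\<Sum>i\<in>B. f i (w' i)) = (\<Sum>i\<in>A. f i (w i)) + (\<Sum>i\<in>B - A. f i (z i, 0))"
proof -
  have fin: "finite B"
    using assms(3) finite_users by (rule finite_subset)
  \<comment> \<open>Polymorphic in the values, as it serves the vectors \<open>y_plus\<close> and
    \<open>y_minus\<close> and the real-valued \<open>f\<close>.\<close>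
  have split: "(\<Sum>i\<in>B. g i (w' i)) = (\<Sum>i\<in>A. g i (w i)) + (\<Sum>i\<in>B - A. g i (z i, 0))"
    for g :: "'p \<Rightarrow> 'm decision \<Rightarrow> 'c::comm_monoid_add"
    unfolding sum.subset_diff[OF assms(2) fin] w'_def by (simp add: add.commute)
  show plus: "(\<Sum>i\<in>B. y_plus (w' i)) = (\<Sum>i\<in>A. y_plus (w i))"
    using split[of "\<lambda>_. y_plus"] by simp
  have "(\<Sum>i\<in>B. y_minus (w' i)) = (\<Sum>i\<in>A. y_minus (w i))"
    using split[of "\<lambda>_. y_minus"] by simp
  then show "w' \<in> feasible_decisions D B"
    using assms(1,4) plus by (auto simp: feasible_decisions_def w'_def)
  show "(\<Sum>i\<in>B. f i (w' i)) = (\<Sum>i\<in>A. f i (w i)) + (\<Sum>i\<in>B - A. f i (z i, 0))"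
    by (rule split)
qed

lemma feasible_decisions_nonempty:
  assumes "A \<subseteq> U"
  shows "feasible_decisions D A \<noteq> {}"
proof -
  have "\<exists>z. (z, 0) \<in> D i" if "i \<in> A - {}" for i
    using that assms nonempty_D[of i] by (auto simp: private_set_def)
  then obtain z where "\<And>i. i \<in> A - {} \<Longrightarrow> (z i, 0) \<in> D i"
    by metis
  \<comment> \<open>Every function is feasible for the empty set of users, so
    \<open>undefined\<close> can start the extension.\<close>
  moreover have "undefined \<in> feasible_decisions D {}"
    by (simp add: feasible_decisions_def)
  ultimately show ?thesis
    using feasible_decisions_extend(1)[of undefined "{}" A z] assms by blast
qed

text \<open>A continuous objective is maximised over a product of compact sets, cut down by the
  closed condition that the balance \<open>?g\<close> vanishes.\<close>

lemma coalition_benefit_attained: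
  assumes "A \<subseteq> U"
  shows "\<exists>w\<in>feasible_decisions D A.
      coalition_benefit D f fa A = (\<Sum>i\<in>A. f i (w i)) + fa (\<Sum>i\<in>A. y_plus (w i))"
    and "w \<in> feasible_decisions D A \<Longrightarrow>
      (\<Sum>i\<in>A. f i (w i)) + fa (\<Sum>i\<in>A. y_plus (w i)) \<le> coalition_benefit D f fa A"
proof -
  let ?X = "product_topology (\<lambda>i. decision_space (n i)) A :: ('p \<Rightarrow> 'm decision) topology"
  let ?g = "\<lambda>w :: 'p \<Rightarrow> 'm decision. (\<Sum>i\<in>A. y_plus (w i)) - (\<Sum>i\<in>A. y_minus (w i))"
  let ?h = "\<lambda>w. (\<Sum>i\<in>A. f i (w i)) + fa (\<Sum>i\<in>A. y_plus (w i))"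
  let ?V = "{?h w | w. w \<in> feasible_decisions D A}"
  have fin: "finite A"
    using assms finite_users by (rule finite_subset)
  have comp: "continuous_map ?X euclidean (\<lambda>w. g (w i))"
    if "i \<in> A" "continuous_map (decision_space (n i)) euclidean g"
    for i and g :: "'m decision \<Rightarrow> 'c::topological_space"
    using continuous_map_compose[OF
        continuous_map_product_projection[of i A "\<lambda>i. decision_space (n i)", OF that(1)] that(2)]
    by (simp add: o_def)
  have plus: "continuous_map ?X euclidean (\<lambda>w. \<Sum>i\<in>A. y_plus (w i))"
    using fin by (intro continuous_map_sum comp continuous_map_y_plus)
  have minus: "continuous_map ?X euclidean (\<lambda>w. \<Sum>i\<in>A. y_minus (w i))"
    using fin by (intro continuous_map_sum comp continuous_map_y_minus)
  have "continuous_map ?X euclidean (\<lambda>w. fa (\<Sum>i\<in>A. y_plus (w i)))"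
    using continuous_map_compose[OF plus, of euclidean fa] continuous_fa by (simp add: o_def)
  moreover have "continuous_map ?X euclidean (\<lambda>w. \<Sum>i\<in>A. f i (w i))"
    using fin assms by (intro continuous_map_sum comp continuous_f) auto
  ultimately have h: "continuous_map ?X euclidean ?h"
    by (intro continuous_map_add)
  have g: "continuous_map ?X euclidean ?g"
    using plus minus by (intro continuous_map_diff)
  have "compactin ?X (Pi\<^sub>E A D)"
    using assms compact_D by (auto simp: compactin_PiE)
  then have "compact (?h ` {w \<in> Pi\<^sub>E A D. ?g w = 0})"
    using g h by (rule compact_image_on_level_set)
  \<comment> \<open>\<open>feasible_decisions\<close> leaves the values outside \<open>A\<close>
    free, while the product contains only extensional functions. Restriction to \<open>A\<close>
    does not change \<open>?h\<close>, so the attained values agree.\<close>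
  also have "?h ` {w \<in> Pi\<^sub>E A D. ?g w = 0} = ?V"
  proof
    show "?h ` {w \<in> Pi\<^sub>E A D. ?g w = 0} \<subseteq> ?V"
      by (force simp: feasible_decisions_def)
    have "?h w = ?h (restrict w A) \<and> restrict w A \<in> {w \<in> Pi\<^sub>E A D. ?g w = 0}"
      if "w \<in> feasible_decisions D A" for w
      using that by (auto simp: feasible_decisions_def)
    then show "?V \<subseteq> ?h ` {w \<in> Pi\<^sub>E A D. ?g w = 0}"
      by blast
  qed
  finally have V: "compact ?V" .
  have ne: "?V \<noteq> {}"
    using feasible_decisions_nonempty[OF assms] by auto
  note att = maximum_attained[OF V ne, folded coalition_benefit_def]
  show "\<exists>w\<in>feasible_decisions D A. coalition_benefit D f fa A = ?h w"
    using att(1) by blast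
  show "w \<in> feasible_decisions D A \<Longrightarrow> ?h w \<le> coalition_benefit D f fa A"
    using att(2) by blast
qed

text \<open>The main case of \<open>v0\<close> without its side condition, so that monotonicity can
  be proved without case distinctions.\<close>

definition surplus :: "'p set \<Rightarrow> real"
  where "surplus A = coalition_benefit D f fa A - (\<Sum>i\<in>A. private_benefit D f i)"

text \<open>Users who join at their stand-alone optimum contribute exactly the private benefits that
  are subtracted for them.\<close>

lemma surplus_mono:
  assumes "A \<subseteq> B" and "B \<subseteq> U"
  shows "surplus A \<le> surplus B"
proof -
  have A: "A \<subseteq> U" and fin: "finite B"
    using assms finite_users by (auto intro: finite_subset)
  obtain w where w: "w \<in> feasible_decisions D A"
    "coalition_benefit D f fa A = (\<Sum>i\<in>A. f i (w i)) + fa (\<Sum>i\<in>A. y_plus (w i))"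
    using coalition_benefit_attained(1)[OF A] by blast
  have "\<exists>z. (z, 0) \<in> D i \<and> f i (z, 0) = private_benefit D f i" if "i \<in> U" for i
    using private_benefit_attained[OF that] by blast
  then obtain z where z: "\<And>i. i \<in> U \<Longrightarrow> (z i, 0) \<in> D i"
    "\<And>i. i \<in> U \<Longrightarrow> f i (z i, 0) = private_benefit D f i"
    by metis
  let ?w = "\<lambda>i. if i \<in> A then w i else (z i, 0)"
  have zB: "(z i, 0) \<in> D i" if "i \<in> B - A" for i
    using that z(1) assms(2) by blast
  note ext = feasible_decisions_extend[OF w(1) assms zB]
  have "(\<Sum>i\<in>B - A. f i (z i, 0)) = (\<Sum>i\<in>B - A. private_benefit D f i)"
    using assms(2) z(2) by (intro sum.cong) auto
  then have "coalition_benefit D f fa A + (\<Sum>i\<in>B - A. private_benefit D f i)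
      = (\<Sum>i\<in>B. f i (?w i)) + fa (\<Sum>i\<in>B. y_plus (?w i))"
    using w(2) ext(2,3) by simp
  also have "\<dots> \<le> coalition_benefit D f fa B"
    using coalition_benefit_attained(2)[OF assms(2) ext(1)] by simp
  finally show ?thesis
    unfolding surplus_def sum.subset_diff[OF assms(1) fin] by simp
qed

lemma surplus_empty: "surplus {} = 0"
  using coalition_benefit_attained(1)[of "{}"] by (simp add: surplus_def fa_0)

lemma v0_eq_surplus:
  "v0 U a D f fa S = (if a \<in> S \<and> card (S \<inter> U) \<ge> 2 then surplus (S \<inter> U) else 0)"
  by (simp add: v0_def surplus_def)

text \<open>The condition of the main case passes from \<open>S\<close> to \<open>T\<close>. If it
  fails for \<open>S\<close>, nonnegativity of the surplus suffices, which is monotonicity starting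
  from the empty set.\<close>

lemma v0_mono:
  assumes "S \<subseteq> T"
  shows "v0 U a D f fa S \<le> v0 U a D f fa T"
proof -
  have "card (S \<inter> U) \<le> card (T \<inter> U)"
    using assms finite_users by (intro card_mono) auto
  moreover have "surplus (S \<inter> U) \<le> surplus (T \<inter> U)"
    using assms by (intro surplus_mono) auto
  moreover have "0 \<le> surplus (T \<inter> U)"
    using surplus_mono[of "{}" "T \<inter> U"] surplus_empty by simp
  ultimately show ?thesis
    using assms by (auto simp: v0_eq_surplus)
qed

end

section \<open>The least core of a monotone game in which users without the aggregator earn
  nothing\<close>

locale aggregator_game =
  fixes U :: "'p set" and a :: 'p and v :: "'p set \<Rightarrow> real"
  assumes finite_users: "finite U"
    and users_nonempty: "U \<noteq> {}"
    and aggregator: "a \<notin> U"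
    and mono: "\<And>S T. S \<subseteq> T \<Longrightarrow> v S \<le> v T"
    and v_without_aggregator: "\<And>S. a \<notin> S \<Longrightarrow> v S = 0"
    and v_aggregator: "v {a} = 0"
begin

abbreviation N :: "'p set" where "N \<equiv> insert a U"

abbreviation ratio :: "'p set \<Rightarrow> real"
  where "ratio S \<equiv> (v N - v S) / (real (card N) - real (card (S \<inter> U)))"

text \<open>Written as in the final theorem, like \<open>vmax\<close>, so that both can be folded
  there.\<close>

definition bound :: real
  where "bound = Min {ratio S | S. S \<in> proper_coalitions_with N a}"

definition vmax :: real
  where "vmax = Max {v S | S. S \<in> maximal_coalitions_with N a}"

abbreviation user_allocation :: "real \<Rightarrow> 'p \<Rightarrow> real"
  where "user_allocation \<epsilon> \<equiv> \<lambda>i\<in>N. if i = a then v N - \<epsilon> * real (card U) else \<epsilon>"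

lemma card_N: "card N = Suc (card U)"
  using finite_users aggregator by simp

lemma finite_proper: "finite (proper_coalitions_with N a)"
proof (rule finite_subset)
  show "proper_coalitions_with N a \<subseteq> Pow N"
    by (auto simp: proper_coalitions_with_def proper_coalitions_def)
qed (simp add: finite_users)

text \<open>Makes the minimum in \<open>bound\<close> range over a nonempty set; the ratio of this
  coalition is \<open>v N / card N\<close>.\<close>

lemma aggregator_proper: "{a} \<in> proper_coalitions_with N a"
  using users_nonempty aggregator
  by (auto simp: proper_coalitions_with_def proper_coalitions_def)

lemma proper_with_iff:
  "S \<in> proper_coalitions_with N a \<longleftrightarrow> (\<exists>A. A \<subset> U \<and> S = insert a A)"
proof
  assume "S \<in> proper_coalitions_with N a"
  then have "S - {a} \<subset> U" "S = insert a (S - {a})"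
    using aggregator by (auto simp: proper_coalitions_with_def proper_coalitions_def)
  then show "\<exists>A. A \<subset> U \<and> S = insert a A"
    by blast
qed (use aggregator in \<open>auto simp: proper_coalitions_with_def proper_coalitions_def\<close>)

text \<open>As \<open>N\<close> also counts the aggregator, every denominator in
  \<open>ratio\<close> is at least 2.\<close>

lemma card_proper:
  assumes "S \<in> proper_coalitions_with N a"
  shows "card (S \<inter> U) < card U"
proof -
  have "S \<inter> U \<subset> U"
    using assms aggregator by (auto simp: proper_with_iff)
  then show ?thesis
    by (rule psubset_card_mono[OF finite_users])
qed

text \<open>Multiplying out the positive denominators gives the linear form in which core
  constraints appear.\<close>

lemma le_bound_iff:
  "\<epsilon> \<le> bound \<longleftrightarrow> (\<forall>S\<in>proper_coalitions_with N a.
      \<epsilon> * (real (card N) - real (card (S \<inter> U))) \<le> v N - v S)"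
proof -
  have "\<epsilon> \<le> bound \<longleftrightarrow> (\<forall>S\<in>proper_coalitions_with N a. \<epsilon> \<le> ratio S)"
    unfolding bound_def Setcompr_eq_image
    using finite_proper aggregator_proper by (subst Min_ge_iff) auto
  also have "\<dots> \<longleftrightarrow> (\<forall>S\<in>proper_coalitions_with N a.
      \<epsilon> * (real (card N) - real (card (S \<inter> U))) \<le> v N - v S)"
  proof (intro ball_cong refl)
    fix S assume "S \<in> proper_coalitions_with N a"
    then have "0 < real (card N) - real (card (S \<inter> U))"
      using card_proper[of S] by (simp add: card_N)
    then show "\<epsilon> \<le> ratio S \<longleftrightarrow> \<epsilon> * (real (card N) - real (card (S \<inter> U))) \<le> v N - v S"
      by (rule pos_le_divide_eq)
  qed
  finally show ?thesis .
qed

lemma bound_le_ratio: "S \<in> proper_coalitions_with N a \<Longrightarrow> bound \<le> ratio S"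
  unfolding bound_def Setcompr_eq_image using finite_proper by (intro Min_le) auto

lemma bound_nonneg: "0 \<le> bound"
  unfolding le_bound_iff
  by (auto simp: proper_coalitions_with_def proper_coalitions_def intro: mono)

text \<open>Stated for every real \<epsilon>, because \<open>least_core_value\<close> is a maximum
  over all reals.\<close>

lemma strong_core_le_bound:
  assumes "x \<in> strong_core N v \<epsilon>"
  shows "\<epsilon> \<le> bound"
  unfolding le_bound_iff
proof
  fix S assume S: "S \<in> proper_coalitions_with N a"
  then obtain A where A: "A \<subset> U" "S = insert a A"
    by (auto simp: proper_with_iff)
  have total: "sum x N = v N" and core: "\<And>T. T \<in> proper_coalitions N \<Longrightarrow> v T + \<epsilon> \<le> sum x T"
    using assms by (auto simp: strong_core_def)
  have SU: "S \<inter> U = A" and diff: "N - S = U - A"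
    using A aggregator by auto
  \<comment> \<open>A single user has value 0, so the constraint of \<open>{i}\<close> is just a
    lower bound on \<open>x i\<close>.\<close>
  have "\<epsilon> \<le> x i" if "i \<in> U - A" for i
  proof -
    have "{i} \<in> proper_coalitions N" "a \<noteq> i"
      using that aggregator by (auto simp: proper_coalitions_def)
    then show ?thesis
      using core[of "{i}"] v_without_aggregator[of "{i}"] by simp
  qed
  then have "real (card (U - A)) * \<epsilon> \<le> sum x (U - A)"
    by (rule sum_bounded_below)
  moreover have "v S + \<epsilon> \<le> sum x S"
    using S by (intro core) (simp add: proper_coalitions_with_def)
  moreover have "sum x N = sum x (U - A) + sum x S"
    using sum.subset_diff[of S N x] A finite_users unfolding diff by auto
  moreover have "real (card (U - A)) = real (card U) - real (card A)"
    using A finite_users by (auto simp: card_Diff_subset finite_subset card_mono of_nat_diff)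
  \<comment> \<open>The users outside \<open>S\<close> give \<open>card U - card A\<close> copies of
    \<epsilon> and the constraint of \<open>S\<close> one more, in all
    \<open>card N - card A\<close>.\<close>
  ultimately show "\<epsilon> * (real (card N) - real (card (S \<inter> U))) \<le> v N - v S"
    using total unfolding SU card_N by (simp add: algebra_simps)
qed

text \<open>The aggregator's share makes the constraint of \<open>insert a A\<close> coincide with
  the inequality of \<open>le_bound_iff\<close>.\<close>

lemma user_allocation_in_core:
  assumes "0 \<le> \<epsilon>" and "\<epsilon> \<le> bound"
  shows "user_allocation \<epsilon> \<in> strong_core N v \<epsilon>"
proof -
  have users: "sum (user_allocation \<epsilon>) A = real (card A) * \<epsilon>" if "A \<subseteq> U" for A
  proof -
    have "sum (user_allocation \<epsilon>) A = (\<Sum>i\<in>A. \<epsilon>)"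
      using that aggregator by (intro sum.cong) auto
    then show ?thesis by simp
  qed
  have with_a: "sum (user_allocation \<epsilon>) (insert a A)
      = v N - \<epsilon> * real (card U) + real (card A) * \<epsilon>" if "A \<subseteq> U" for A
    using that aggregator finite_users users[OF that] by (subst sum.insert) (auto intro: finite_subset)
  have "v S + \<epsilon> \<le> sum (user_allocation \<epsilon>) S" if S: "S \<in> proper_coalitions N" for S
  proof (cases "a \<in> S")
    case True
    then have SP: "S \<in> proper_coalitions_with N a"
      using S by (simp add: proper_coalitions_with_def)
    then obtain A where A: "A \<subset> U" "S = insert a A"
      by (auto simp: proper_with_iff)
    then have SU: "S \<inter> U = A" and "A \<subseteq> U"
      using aggregator by auto
    have "\<epsilon> * (real (card N) - real (card A)) \<le> v N - v S"
      using assms(2) SP unfolding le_bound_iff SU[symmetric] by blast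
    then show ?thesis
      using with_a[OF \<open>A \<subseteq> U\<close>] unfolding A(2) card_N by (simp add: algebra_simps)
  next
    case False
    then have "S \<subseteq> U" "S \<noteq> {}"
      using S by (auto simp: proper_coalitions_def)
    then have "0 < card S"
      using finite_users by (meson card_gt_0_iff finite_subset)
    \<comment> \<open>The sign of \<epsilon> enters here: a nonempty set of users receives at least
      one \<epsilon>.\<close>
    then have "1 * \<epsilon> \<le> real (card S) * \<epsilon>"
      using assms(1) by (intro mult_right_mono) auto
    then show ?thesis
      using users[OF \<open>S \<subseteq> U\<close>] v_without_aggregator[OF False] by simp
  qed
  moreover have "sum (user_allocation \<epsilon>) N = v N"
    using with_a[of U] by simp
  ultimately show ?thesis
    by (auto simp: strong_core_def)
qed

text \<open>Being nonnegative, \<open>bound\<close> is itself admissible, so the upper bound on all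
  admissible values is attained.\<close>

lemma least_core_value_eq_bound: "least_core_value N v = bound"
  unfolding least_core_value_def
proof (rule maximum_eqI)
  show "bound \<in> {\<epsilon>. strong_core N v \<epsilon> \<noteq> {}}"
    using user_allocation_in_core[OF bound_nonneg] by auto
qed (auto dest: strong_core_le_bound)

section \<open>Coalitions missing a single user, and the explicit estimates\<close>

lemma maximal_subset: "maximal_coalitions_with N a \<subseteq> proper_coalitions_with N a"
  by (auto simp: maximal_coalitions_with_def)

lemma insert_diff_maximal:
  assumes "i \<in> U"
  shows "insert a (U - {i}) \<in> maximal_coalitions_with N a"
proof -
  have "insert a (U - {i}) \<in> proper_coalitions_with N a"
    using assms by (auto simp: proper_with_iff)
  moreover have "card (insert a (U - {i})) = card N - 1"
    using assms aggregator finite_users card_Suc_Diff1[OF finite_users assms] by simp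
  ultimately show ?thesis
    by (simp add: maximal_coalitions_with_def)
qed

lemma finite_maximal: "finite (maximal_coalitions_with N a)"
  using maximal_subset finite_proper by (rule finite_subset)

text \<open>Some user \<open>i\<close> is missing from \<open>S\<close>; by \<open>mono\<close>,
  adding all the others can only raise the value.\<close>

lemma v_le_vmax:
  assumes "S \<in> proper_coalitions_with N a"
  shows "v S \<le> vmax"
proof -
  obtain A where A: "A \<subset> U" "S = insert a A"
    using assms by (auto simp: proper_with_iff)
  then obtain i where i: "i \<in> U" "i \<notin> A"
    by blast
  have "v S \<le> v (insert a (U - {i}))"
    using A i by (intro mono) auto
  also have "\<dots> \<le> vmax"
    unfolding vmax_def Setcompr_eq_image
    using finite_maximal insert_diff_maximal[OF i(1)] by (intro Max_ge) auto
  finally show ?thesis .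
qed

text \<open>Each ratio has numerator at least \<open>v N - vmax\<close> and denominator at most
  \<open>card N\<close>. Enlarging the denominator is sound because \<open>mono\<close> makes
  \<open>v N - v S\<close> nonnegative.\<close>

lemma bound_ge: "(v N - vmax) / real (card N) \<le> bound"
  unfolding le_bound_iff
proof
  fix S assume S: "S \<in> proper_coalitions_with N a"
  let ?d = "real (card N) - real (card (S \<inter> U))"
  have d: "0 \<le> ?d" "?d \<le> real (card N)" and N: "0 < real (card N)"
    using card_proper[OF S] by (auto simp: card_N)
  have "(v N - vmax) / real (card N) * ?d \<le> (v N - v S) / real (card N) * ?d"
    using v_le_vmax[OF S] d(1) by (intro mult_right_mono divide_right_mono) auto
  also have "\<dots> \<le> (v N - v S) / real (card N) * real (card N)"
    using S d(2) by (intro mult_left_mono)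
      (auto simp: proper_coalitions_with_def proper_coalitions_def intro!: divide_nonneg_nonneg mono)
  finally show "(v N - vmax) / real (card N) * ?d \<le> v N - v S"
    using N by simp
qed

text \<open>Two coalitions are tested: the aggregator alone, and a maximal coalition attaining
  \<open>vmax\<close>.\<close>

lemma bound_le: "bound \<le> min (v N / real (card N)) ((v N - vmax) / 2)"
proof -
  have "{a} \<inter> U = {}"
    using aggregator by simp
  then have "bound \<le> v N / real (card N)"
    using bound_le_ratio[OF aggregator_proper] v_aggregator by simp
  moreover have "bound \<le> (v N - vmax) / 2"
  proof -
    have "vmax \<in> v ` maximal_coalitions_with N a"
      unfolding vmax_def Setcompr_eq_image
      using finite_maximal insert_diff_maximal users_nonempty by (intro Max_in) auto
    then obtain S where S: "S \<in> maximal_coalitions_with N a" "vmax = v S"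
      by blast
    then have SP: "S \<in> proper_coalitions_with N a"
      using maximal_subset by blast
    then obtain A where A: "A \<subset> U" "S = insert a A"
      by (auto simp: proper_with_iff)
    then have SU: "S \<inter> U = A" and "a \<notin> A" "finite A"
      using aggregator finite_users by (auto intro: finite_subset)
    then have "Suc (card A) = card U"
      using S(1) A(2) by (simp add: maximal_coalitions_with_def card_N)
    \<comment> \<open>The 2 counts the missing user and the aggregator.\<close>
    then have "real (card N) - real (card (S \<inter> U)) = 2"
      unfolding SU card_N by simp
    then show ?thesis
      using bound_le_ratio[OF SP] S(2) by simp
  qed
  ultimately show ?thesis by simp
qed

end

theorem theorem2:
  fixes U :: "'p set"
    and a :: 'p
    and n :: "'p \<Rightarrow> nat"
    and D :: "'p \<Rightarrow> 'm::finite decision set"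
    and f :: "'p \<Rightarrow> 'm decision \<Rightarrow> real"
    and fa :: "real^'m \<Rightarrow> real"
  assumes "energy_sharing_game U a n D f fa"
  shows
    "let N = insert a U;
         v = v0 U a D f fa;
         \<epsilon>0 = least_core_value N v;
         bound = Min {(v N - v S) / (real (card N) - real (card (S \<inter> U))) | S.
                        S \<in> proper_coalitions_with N a};
         vmax = Max {v S | S. S \<in> maximal_coalitions_with N a}
     in
       (\<forall>\<epsilon>\<ge>0.
          (strong_core N v \<epsilon> \<noteq> {} \<longleftrightarrow>
             (\<lambda>i\<in>N. if i = a then v N - \<epsilon> * real (card U) else \<epsilon>) \<in> strong_core N v \<epsilon>) \<and>
          ((\<lambda>i\<in>N. if i = a then v N - \<epsilon> * real (card U) else \<epsilon>) \<in> strong_core N v \<epsilon> \<longleftrightarrow>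
             \<epsilon> \<le> bound)) \<and>
       \<epsilon>0 = bound \<and>
       \<epsilon>0 \<ge> (v N - vmax) / real (card N) \<and>
       \<epsilon>0 \<le> min (v N / real (card N)) ((v N - vmax) / 2)"
proof -
  interpret E: energy_sharing_game U a n D f fa
    by (rule assms)
  \<comment> \<open>The core argument takes from the game only \<open>v0_mono\<close> and the zero
    cases of \<open>v0\<close>.\<close>
  interpret G: aggregator_game U a "v0 U a D f fa"
  proof
    show "v0 U a D f fa S \<le> v0 U a D f fa T" if "S \<subseteq> T" for S T
      using that by (rule E.v0_mono)
    show "U \<noteq> {}"
      using E.two_users by auto
    show "v0 U a D f fa {a} = 0"
      using E.aggregator by (simp add: v0_def)
  qed (simp_all add: E.finite_users E.aggregator v0_def)
  \<comment> \<open>The equivalences close in a circle: a nonempty core gives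
    \<open>\<epsilon> \<le> bound\<close>, this puts the user allocation into the core, and that
    allocation witnesses nonemptiness.\<close>
  show ?thesis
    unfolding Let_def G.bound_def[symmetric] G.vmax_def[symmetric] G.least_core_value_eq_bound
    using G.user_allocation_in_core G.strong_core_le_bound G.bound_ge G.bound_le by blast
qed

end
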